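(* Let $ABC$ be a triangle. Draw lines $l_A, l_B, l_C$ through the vertices $A, B, C$ respectively, and let $l'_A, l'_B, l'_C$ be the lines symmetric to $l_A, l_B, l_C$ with respect to the bisectors of the angles $A, B, C$ of the triangle, respectively. Let $X, Y, Z$ be the intersection points of $l_B$ and $l'_C$, of $l_C$ and $l'_A$, and of $l_A$ and $l'_B$, respectively. Let $X', Y', Z'$ be the intersection points of $l'_B$ and $l_C$, of $l'_C$ and $l_A$, and of $l'_A$ and $l_B$, respectively. Let $R$ be the intersection point of the lines $AX$, $BY$, $CZ$, and let $R'$ be the intersection point of the lines $AX'$, $BY'$, $CZ'$. Then the lines $XX'$, $YY'$, $ZZ'$ and $RR'$ intersect at a point.
   Context: The setting is the Euclidean plane. In this configuration the three lines $AX, BY, CZ$ are concurrent, and so are the three lines $AX', BY', CZ'$; this is what defines $R$ and $R'$.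
   Formalization: The conclusion is that XX', YY', ZZ', RR' have a common point or are all four parallel; without the parallel case the claim fails for some configurations, e.g. in an equilateral triangle. *)

theory Defs
  imports "HOL-Analysis.Analysis"
begin

definition is_line :: "(real^2) set \<Rightarrow> bool" where
  "is_line l \<longleftrightarrow> affine l \<and> aff_dim l = 1"

definition vec_angle :: "real^2 \<Rightarrow> real^2 \<Rightarrow> real" where
  "vec_angle u v = arccos ((u \<bullet> v) / (norm u * norm v))"

text \<open>The bisector of the angle at the vertex \<open>A\<close> between the rays \<open>AB\<close> and \<open>AC\<close>, as a full line.
  Equality of the undirected angles with the two rays singles out the internal bisector: on its
  extension beyond \<open>A\<close> both angles are replaced by their supplements, while on the external bisector
  the two angles are supplementary to each other. The vertex itself is included, because
  \<open>0 / 0 = 0\<close> makes both angles equal there.\<close>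

definition angle_bisector :: "real^2 \<Rightarrow> real^2 \<Rightarrow> real^2 \<Rightarrow> (real^2) set" where
  "angle_bisector A B C = {P. vec_angle (P - A) (B - A) = vec_angle (P - A) (C - A)}"

text \<open>Reflection in a line: the foot of the perpendicular from \<open>P\<close> is the midpoint of \<open>P\<close> and its image.\<close>

definition reflect_in :: "(real^2) set \<Rightarrow> real^2 \<Rightarrow> real^2" where
  "reflect_in m P = 2 *\<^sub>R closest_point m P - P"

lemma mem_angle_bisector_iff:
  assumes "B \<noteq> A" "C \<noteq> A"
  shows "P \<in> angle_bisector A B C \<longleftrightarrow> (P - A) \<bullet> sgn (B - A) = (P - A) \<bullet> sgn (C - A)"
proof (cases "P = A")
  case True
  then show ?thesis by (simp add: angle_bisector_def vec_angle_def)
next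
  case False
  have bound: "\<bar>((P - A) \<bullet> w) / (norm (P - A) * norm w)\<bar> \<le> 1" for w
    using Cauchy_Schwarz_ineq2[of "P - A" w]
    by (cases "w = 0") (use False in \<open>simp_all add: abs_mult divide_le_eq_1\<close>)
  have "P \<in> angle_bisector A B C \<longleftrightarrow>
      ((P - A) \<bullet> (B - A)) / (norm (P - A) * norm (B - A)) =
      ((P - A) \<bullet> (C - A)) / (norm (P - A) * norm (C - A))"
    unfolding angle_bisector_def vec_angle_def using arccos_eq_iff bound by simp
  also have "\<dots> \<longleftrightarrow> (P - A) \<bullet> sgn (B - A) = (P - A) \<bullet> sgn (C - A)"
    unfolding sgn_div_norm inner_scaleR_right using False assms by (simp add: divide_simps mult.commute)
  finally show ?thesis .
qed

lemma orthogonal_pair_zero: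
  fixes w d s :: "real^2"
  assumes "d \<noteq> 0" "s \<noteq> 0" "d \<bullet> s = 0" "w \<bullet> d = 0" "w \<bullet> s = 0"
  shows "w = 0"
proof -
  have ds: "d$1 * s$1 + d$2 * s$2 = 0" and wd: "w$1 * d$1 + w$2 * d$2 = 0"
    and ws: "w$1 * s$1 + w$2 * s$2 = 0"
    using assms(3-5) by (simp_all add: inner_vec_def sum_2)
  have "w$1 * (d$1 * s$2 - d$2 * s$1) = 0" "w$2 * (d$1 * s$2 - d$2 * s$1) = 0"
    using wd ws by algebra+
  moreover have "d$1 * s$2 - d$2 * s$1 \<noteq> 0"
  proof
    assume "d$1 * s$2 - d$2 * s$1 = 0"
    then have "((d$1)\<^sup>2 + (d$2)\<^sup>2) * ((s$1)\<^sup>2 + (s$2)\<^sup>2) = 0"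
      using ds by algebra
    then show False
      using assms(1,2) by (auto simp: vec_eq_iff forall_2 sum_power2_eq_zero_iff)
  qed
  ultimately show ?thesis by (simp add: vec_eq_iff forall_2)
qed

lemma angle_bisector_eq_affine_hull:
  assumes "\<not> collinear {A, B, C}"
  shows "angle_bisector A B C = affine hull {A, A + (sgn (B - A) + sgn (C - A))}"
proof -
  define u where "u = sgn (B - A)"
  define v where "v = sgn (C - A)"
  have ne: "B \<noteq> A" "C \<noteq> A"
    using assms by (auto simp: insert_commute)
  have B: "B = A + norm (B - A) *\<^sub>R u" and C: "C = A + norm (C - A) *\<^sub>R v"
    using ne by (auto simp: u_def v_def sgn_div_norm)
  have nu: "u \<bullet> u = 1" and nv: "v \<bullet> v = 1"
    using ne by (auto simp: u_def v_def dot_square_norm norm_sgn)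
  have indep: "u \<noteq> s *\<^sub>R v" for s
  proof
    assume "u = s *\<^sub>R v"
    then have "B = A + (norm (B - A) * s) *\<^sub>R v" using B by simp
    then have "\<forall>y\<in>{A, B, C}. \<exists>c. y = A + c *\<^sub>R v"
      using C by (metis add.right_neutral empty_iff insert_iff scaleR_zero_left)
    then show False using assms collinear_alt by blast
  qed
  have d: "u - v \<noteq> 0" and s: "u + v \<noteq> 0"
    using indep[of 1] indep[of "-1"] by (auto simp: eq_neg_iff_add_eq_0)
  have ds: "(u - v) \<bullet> (u + v) = 0"
    using nu nv by (simp add: inner_simps inner_commute)
  have "P \<in> angle_bisector A B C \<longleftrightarrow> (\<exists>k. P = A + k *\<^sub>R (u + v))" for P
  proof
    assume "P \<in> angle_bisector A B C"
    then have pd: "(P - A) \<bullet> (u - v) = 0"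
      using mem_angle_bisector_iff[OF ne] by (simp add: u_def v_def inner_simps)
    define k where "k = ((P - A) \<bullet> (u + v)) / ((u + v) \<bullet> (u + v))"
    have "P - A - k *\<^sub>R (u + v) = 0"
    proof (rule orthogonal_pair_zero[OF d s ds])
      show "(P - A - k *\<^sub>R (u + v)) \<bullet> (u - v) = 0"
        unfolding inner_diff_left[of "P - A"] inner_scaleR_left inner_commute[of "u + v"] pd ds
        by simp
      show "(P - A - k *\<^sub>R (u + v)) \<bullet> (u + v) = 0"
        using s by (simp add: k_def inner_diff_left)
    qed
    then show "\<exists>k. P = A + k *\<^sub>R (u + v)" by (metis add.commute diff_eq_eq eq_iff_diff_eq_0)
  next
    assume "\<exists>k. P = A + k *\<^sub>R (u + v)"
    then obtain k where "P = A + k *\<^sub>R (u + v)" ..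
    then have "P - A = k *\<^sub>R (u + v)" by simp
    then have "(P - A) \<bullet> u = (P - A) \<bullet> v"
      using nu nv by (simp add: inner_add_left inner_add_right inner_commute[of v u])
    then show "P \<in> angle_bisector A B C"
      using mem_angle_bisector_iff[OF ne] by (simp add: u_def v_def)
  qed
  moreover have "P \<in> affine hull {A, A + (u + v)} \<longleftrightarrow> (\<exists>k. P = A + k *\<^sub>R (u + v))" for P
    unfolding affine_hull_2_alt by auto
  ultimately show ?thesis unfolding u_def v_def by blast
qed

end

theory Submission imports Defs begin

text \<open>
  In homogeneous trilinear coordinates with respect to \<open>ABC\<close>, the reflection in a bisector exchanges
  two coordinates. If \<open>l\<^sub>A\<close>, \<open>l\<^sub>B\<close>, \<open>l\<^sub>C\<close> are given by \<open>y : z = a1 : a2\<close>, \<open>z : x = b1 : b2\<close>,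
  \<open>x : y = c1 : c2\<close>, then \<open>X = (b2 c2 : b2 c1 : b1 c2)\<close>, \<open>X' = (b1 c1 : b1 c2 : b2 c1)\<close>,
  \<open>R = (a2 b1 c1 : a1 b2 c1 : a1 b1 c2)\<close>, \<open>R' = (a1 b2 c2 : a2 b1 c2 : a2 b2 c1)\<close>, with cyclic formulas
  for the other points, and as vectors \<open>R + R' = a1 X + a2 X' = b1 Y + b2 Y' = c1 Z + c2 Z'\<close>.
  This vector represents the common point, which may lie at infinity.
\<close>

section \<open>Reflection in an angle bisector as an exchange of coordinates\<close>

lemma noncollinear_independent:
  fixes A B C :: "'a::euclidean_space"
  assumes "\<not> collinear {A, B, C}" "x *\<^sub>R A + y *\<^sub>R B + z *\<^sub>R C = 0" "x + y + z = 0"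
  shows "x = 0" "y = 0" "z = 0"
proof -
  have x: "x = - y - z" using assms(3) by simp
  have eq: "y *\<^sub>R (B - A) + z *\<^sub>R (C - A) = 0"
    using assms(2) unfolding x by (simp add: algebra_simps)
  have y: "y = 0"
  proof (rule ccontr)
    assume "y \<noteq> 0"
    have "y *\<^sub>R (B - A) = (- z) *\<^sub>R (C - A)" using eq by (simp add: eq_neg_iff_add_eq_0)
    then have "(1/y) *\<^sub>R (y *\<^sub>R (B - A)) = (1/y) *\<^sub>R ((- z) *\<^sub>R (C - A))" by simp
    then have "B = A + (- z / y) *\<^sub>R (C - A)" using \<open>y \<noteq> 0\<close> by (simp add: algebra_simps)
    then have "\<forall>w\<in>{A, B, C}. \<exists>k. w = A + k *\<^sub>R (C - A)"
      by (metis add.right_neutral add_diff_cancel_left' diff_add_cancel add.commute empty_iff insert_iff scaleR_one scaleR_zero_left)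
    then show False using assms(1) collinear_alt by blast
  qed
  have "C \<noteq> A" using assms(1) by (auto simp: insert_commute)
  then show "z = 0" using eq y by simp
  then show "x = 0" using x y by simp
  show "y = 0" by (fact y)
qed

text \<open>With \<beta> and \<gamma> the side lengths \<open>CA\<close> and \<open>AB\<close>, this
  is the line through \<open>A\<close> with trilinear ratio \<open>y : z = p : q\<close>: the
  factors \<beta>, \<gamma> convert trilinear to barycentric coordinates. If \<open>p\<close> and
  \<open>q\<close> both vanish it degenerates to the point \<open>A\<close>.\<close>

definition weighted_line ::
  "real \<Rightarrow> real \<Rightarrow> 'a::real_vector \<Rightarrow> 'a \<Rightarrow> 'a \<Rightarrow> real \<Rightarrow> real \<Rightarrow> 'a set" where
  "weighted_line \<beta> \<gamma> A B C p q =
     range (\<lambda>t. A + t *\<^sub>R ((p * \<beta>) *\<^sub>R (B - A) + (q * \<gamma>) *\<^sub>R (C - A)))"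

text \<open>The vectors \<open>u + v\<close> and \<open>u - v\<close> are orthogonal because
  \<open>u\<close> and \<open>v\<close> have equal length. Reflection keeps the component
  \<open>(p + q) / 2\<close> along the first and negates the component \<open>(p - q) / 2\<close>
  along the second, which exchanges \<open>p\<close> and \<open>q\<close>.\<close>

lemma reflect_in_swap:
  assumes "norm u = 1" "norm v = 1" "u + v \<noteq> 0"
  shows "reflect_in (affine hull {A, A + (u + v)}) (A + (p *\<^sub>R u + q *\<^sub>R v))
    = A + (q *\<^sub>R u + p *\<^sub>R v)"
proof -
  let ?m = "affine hull {A, A + (u + v)}"
  have m: "?m = range (\<lambda>k. A + k *\<^sub>R (u + v))"
    unfolding affine_hull_2_alt by auto
  have dots: "u \<bullet> u = 1" "v \<bullet> v = 1"
    using assms by (simp_all add: dot_square_norm)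
  have "closest_point ?m (A + (p *\<^sub>R u + q *\<^sub>R v)) = A + ((p + q) / 2) *\<^sub>R (u + v)" (is "_ = ?F")
  proof (rule closest_point_unique[symmetric, where S = ?m])
    show "convex ?m" by (simp add: affine_imp_convex)
    show "closed ?m" by simp
    show "?F \<in> ?m" unfolding m by blast
    show "\<forall>z\<in>?m. dist (A + (p *\<^sub>R u + q *\<^sub>R v)) ?F \<le> dist (A + (p *\<^sub>R u + q *\<^sub>R v)) z"
    proof
      fix z assume "z \<in> ?m"
      then obtain k where z: "z = A + k *\<^sub>R (u + v)" unfolding m by blast
      \<comment> \<open>\<open>?e\<close> is the perpendicular from the claimed foot
        \<open>?F\<close>, and \<open>?r\<close> runs along the line from \<open>z\<close> to
        \<open>?F\<close>; Pythagoras then shows that no \<open>z\<close> is closer than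
        \<open>?F\<close>.\<close>
      let ?e = "((p - q) / 2) *\<^sub>R (u - v)" and ?r = "((p + q) / 2 - k) *\<^sub>R (u + v)"
      have e: "A + (p *\<^sub>R u + q *\<^sub>R v) - ?F = ?e"
        by (simp add: vec_eq_iff field_simps)
      have er: "A + (p *\<^sub>R u + q *\<^sub>R v) - z = ?e + ?r"
        unfolding z by (simp add: vec_eq_iff field_simps)
      have "(u - v) \<bullet> (u + v) = 0"
        using dots by (simp add: inner_simps inner_commute)
      then have "?e \<bullet> ?r = 0" by simp
      then have "(norm (?e + ?r))\<^sup>2 = (norm ?e)\<^sup>2 + (norm ?r)\<^sup>2"
        by (simp only: norm_add_Pythagorean orthogonal_def)
      then have "(norm ?e)\<^sup>2 \<le> (norm (?e + ?r))\<^sup>2" by simp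
      then have "norm ?e \<le> norm (?e + ?r)" by (rule power2_le_imp_le) simp
      then show "dist (A + (p *\<^sub>R u + q *\<^sub>R v)) ?F \<le> dist (A + (p *\<^sub>R u + q *\<^sub>R v)) z"
        unfolding dist_norm e er .
    qed
  qed
  then have "reflect_in ?m (A + (p *\<^sub>R u + q *\<^sub>R v)) = 2 *\<^sub>R ?F - (A + (p *\<^sub>R u + q *\<^sub>R v))"
    unfolding reflect_in_def by simp
  also have "\<dots> = A + (q *\<^sub>R u + p *\<^sub>R v)"
    by (simp add: vec_eq_iff field_simps)
  finally show ?thesis .
qed

text \<open>The coefficients \<open>p\<close>, \<open>q\<close> are those of a direction of
  \<open>l\<close> in the basis of unit vectors along \<open>AB\<close> and \<open>AC\<close>. The
  reflection exchanges these two vectors, hence \<open>p\<close> and \<open>q\<close>.\<close>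

lemma isogonal_lines:
  fixes A B C :: "real^2"
  assumes tri: "\<not> collinear {A, B, C}" and l: "is_line l" "A \<in> l"
  obtains p q where "p \<noteq> 0 \<or> q \<noteq> 0"
    "l = weighted_line (dist C A) (dist A B) A B C p q"
    "reflect_in (angle_bisector A B C) ` l = weighted_line (dist C A) (dist A B) A B C q p"
proof -
  define u v where "u = sgn (B - A)" and "v = sgn (C - A)"
  have ne: "B \<noteq> A" "C \<noteq> A" using tri by (auto simp: insert_commute)
  then have pos: "dist A B > 0" "dist C A > 0" by auto
  have u: "B - A = dist A B *\<^sub>R u" and v: "C - A = dist C A *\<^sub>R v"
    using ne by (auto simp: u_def v_def sgn_div_norm dist_norm norm_minus_commute)
  have unit: "norm u = 1" "norm v = 1" using ne by (auto simp: u_def v_def norm_sgn)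
  have indep: "x = 0 \<and> y = 0" if "x *\<^sub>R u + y *\<^sub>R v = 0" for x y
  proof -
    have "u = (1 / dist A B) *\<^sub>R (B - A)" "v = (1 / dist C A) *\<^sub>R (C - A)"
      using u v pos by auto
    then have "(x / dist A B) *\<^sub>R (B - A) + (y / dist C A) *\<^sub>R (C - A) = 0"
      using that by simp
    then have "(- x / dist A B - y / dist C A) *\<^sub>R A + (x / dist A B) *\<^sub>R B
        + (y / dist C A) *\<^sub>R C = 0"
      by (simp add: algebra_simps)
    from noncollinear_independent[OF tri this] show ?thesis using ne by simp
  qed
  have s: "u + v \<noteq> 0" using indep[of 1 1] by auto
  obtain D where D: "D \<in> l" "D \<noteq> A"
  proof -
    have "l \<noteq> {A}" using l(1) by (auto simp: is_line_def)
    then show ?thesis using l(2) that by auto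
  qed
  have hull: "l = affine hull {A, D}"
  proof (rule affine_dim_equal[symmetric])
    show "affine hull {A, D} \<subseteq> l"
      using D l by (simp add: hull_minimal is_line_def)
    show "aff_dim (affine hull {A, D}) = aff_dim l"
      using D(2) l(1) by (simp add: is_line_def aff_dim_2)
  qed (use l in \<open>simp_all add: is_line_def\<close>)
  have "\<exists>p q. D - A = p *\<^sub>R u + q *\<^sub>R v"
  proof -
    \<comment> \<open>Cramer's rule: \<open>?d\<close> is the determinant of \<open>u\<close> and
      \<open>v\<close>, nonzero by their linear independence.\<close>
    let ?d = "u $ 1 * v $ 2 - u $ 2 * v $ 1"
    have "?d \<noteq> 0"
    proof
      assume d: "?d = 0"
      have "(v $ 2) *\<^sub>R u + (- u $ 2) *\<^sub>R v = 0" "(v $ 1) *\<^sub>R u + (- u $ 1) *\<^sub>R v = 0"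
        using d by (simp_all add: vec_eq_iff forall_2 mult.commute)
      from this[THEN indep] have "v = 0" by (simp add: vec_eq_iff forall_2)
      then show False using unit by simp
    qed
    then have "D - A = (((D - A) $ 1 * v $ 2 - (D - A) $ 2 * v $ 1) / ?d) *\<^sub>R u
        + ((u $ 1 * (D - A) $ 2 - u $ 2 * (D - A) $ 1) / ?d) *\<^sub>R v"
      by (simp add: vec_eq_iff forall_2 divide_simps) (simp add: algebra_simps)
    then show ?thesis by blast
  qed
  then obtain p q where pq: "D - A = p *\<^sub>R u + q *\<^sub>R v" by blast
  have wl: "weighted_line (dist C A) (dist A B) A B C x y = range (\<lambda>t. A + ((t * x) *\<^sub>R u + (t * y) *\<^sub>R v))" for x y
  proof -
    \<comment> \<open>Weighting each side vector by the length of the other side gives both unit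
      vectors the same factor, which the line parameter absorbs.\<close>
    have *: "(x * dist C A) *\<^sub>R (B - A) + (y * dist A B) *\<^sub>R (C - A) = (dist C A * dist A B) *\<^sub>R (x *\<^sub>R u + y *\<^sub>R v)"
      unfolding u v by (simp add: algebra_simps)
    show ?thesis unfolding weighted_line_def *
    proof (intro set_eqI iffI)
      fix z assume "z \<in> range (\<lambda>t. A + t *\<^sub>R (dist C A * dist A B) *\<^sub>R (x *\<^sub>R u + y *\<^sub>R v))"
      then obtain t where "z = A + t *\<^sub>R (dist C A * dist A B) *\<^sub>R (x *\<^sub>R u + y *\<^sub>R v)" by blast
      then have "z = A + ((t * (dist C A * dist A B) * x) *\<^sub>R u + (t * (dist C A * dist A B) * y) *\<^sub>R v)"
        by (simp add: scaleR_add_right mult.assoc)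
      then show "z \<in> range (\<lambda>t. A + ((t * x) *\<^sub>R u + (t * y) *\<^sub>R v))" by blast
    next
      fix z assume "z \<in> range (\<lambda>t. A + ((t * x) *\<^sub>R u + (t * y) *\<^sub>R v))"
      then obtain t where "z = A + ((t * x) *\<^sub>R u + (t * y) *\<^sub>R v)" by blast
      then have "z = A + (t / (dist C A * dist A B)) *\<^sub>R (dist C A * dist A B) *\<^sub>R (x *\<^sub>R u + y *\<^sub>R v)"
        using ne by (simp add: scaleR_add_right)
      then show "z \<in> range (\<lambda>t. A + t *\<^sub>R (dist C A * dist A B) *\<^sub>R (x *\<^sub>R u + y *\<^sub>R v))" by blast
    qed
  qed
  have l_eq: "l = range (\<lambda>t. A + ((t * p) *\<^sub>R u + (t * q) *\<^sub>R v))"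
    unfolding hull affine_hull_2_alt pq by (simp add: scaleR_add_right)
  show ?thesis
  proof
    show "p \<noteq> 0 \<or> q \<noteq> 0" using pq D(2) by auto
    show "l = weighted_line (dist C A) (dist A B) A B C p q" using l_eq wl by simp
    show "reflect_in (angle_bisector A B C) ` l = weighted_line (dist C A) (dist A B) A B C q p"
      unfolding l_eq wl image_image angle_bisector_eq_affine_hull[OF tri]
        u_def[symmetric] v_def[symmetric] reflect_in_swap[OF unit s] by (simp add: add.commute)
  qed
qed

section \<open>Intersections of lines through two vertices\<close>

text \<open>
  If \<open>V\<close> of weight \<open>w\<close> is a homogeneous vector on both lines, then \<open>V + (1 - w) X\<close> lies on both
  lines again, hence equals \<open>X\<close>. No case distinction on \<open>w = 0\<close> is needed.
\<close>

lemma weighted_line_meet: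
  assumes "weighted_line \<gamma> \<alpha> B C A b1 b2 \<inter> weighted_line \<alpha> \<beta> C A B c2 c1 = {X}"
  shows "(b2 * c2 * \<alpha>) *\<^sub>R A + (b2 * c1 * \<beta>) *\<^sub>R B + (b1 * c2 * \<gamma>) *\<^sub>R C
    = (b2 * c2 * \<alpha> + b2 * c1 * \<beta> + b1 * c2 * \<gamma>) *\<^sub>R X" (is "?V = ?w *\<^sub>R X")
proof -
  have "X \<in> weighted_line \<gamma> \<alpha> B C A b1 b2" "X \<in> weighted_line \<alpha> \<beta> C A B c2 c1"
    using assms by auto
  then obtain s t where
    s: "X = B + s *\<^sub>R ((b1 * \<gamma>) *\<^sub>R (C - B) + (b2 * \<alpha>) *\<^sub>R (A - B))" and
    t: "X = C + t *\<^sub>R ((c2 * \<alpha>) *\<^sub>R (A - C) + (c1 * \<beta>) *\<^sub>R (B - C))"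
    unfolding weighted_line_def by blast
  \<comment> \<open>\<open>?V\<close> is \<open>?w\<close> times \<open>B\<close> plus
    \<open>c2\<close> times the direction of the first line, and also \<open>?w\<close> times
    \<open>C\<close> plus \<open>b2\<close> times the direction of the second. This gives both
    parameters.\<close>
  have "?V + (1 - ?w) *\<^sub>R X =
      B + (c2 + (1 - ?w) * s) *\<^sub>R ((b1 * \<gamma>) *\<^sub>R (C - B) + (b2 * \<alpha>) *\<^sub>R (A - B))"
    unfolding s by (simp add: algebra_simps)
  moreover have "?V + (1 - ?w) *\<^sub>R X =
      C + (b2 + (1 - ?w) * t) *\<^sub>R ((c2 * \<alpha>) *\<^sub>R (A - C) + (c1 * \<beta>) *\<^sub>R (B - C))"
    unfolding t by (simp add: algebra_simps)
  ultimately have "?V + (1 - ?w) *\<^sub>R X \<in>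
      weighted_line \<gamma> \<alpha> B C A b1 b2 \<inter> weighted_line \<alpha> \<beta> C A B c2 c1"
    unfolding weighted_line_def by blast
  then have "?V + (1 - ?w) *\<^sub>R X = X" using assms by simp
  then show ?thesis by (simp add: scaleR_diff_left)
qed

text \<open>If \<open>b2\<close> and \<open>c2\<close> both vanished, both lines would be the side
  \<open>BC\<close> and would share more than one point. Consequently the homogeneous coordinates of
  \<open>X\<close> are not all zero.\<close>

lemma weighted_line_meet_nontrivial:
  assumes "weighted_line \<gamma> \<alpha> B C A b1 b2 \<inter> weighted_line \<alpha> \<beta> C A B c2 c1 = {X}"
    and "B \<noteq> C" "\<beta> \<noteq> 0" "\<gamma> \<noteq> 0" "b1 \<noteq> 0 \<or> b2 \<noteq> 0" "c1 \<noteq> 0 \<or> c2 \<noteq> 0"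
  shows "b2 \<noteq> 0 \<or> c2 \<noteq> 0"
proof (rule ccontr)
  assume "\<not> ?thesis"
  then have z: "b2 = 0" "c2 = 0" and nz: "b1 \<noteq> 0" "c1 \<noteq> 0" using assms by auto
  have "C = B + (1 / (b1 * \<gamma>)) *\<^sub>R ((b1 * \<gamma>) *\<^sub>R (C - B) + (b2 * \<alpha>) *\<^sub>R (A - B))"
    "B = B + 0 *\<^sub>R ((b1 * \<gamma>) *\<^sub>R (C - B) + (b2 * \<alpha>) *\<^sub>R (A - B))"
    "B = C + (1 / (c1 * \<beta>)) *\<^sub>R ((c2 * \<alpha>) *\<^sub>R (A - C) + (c1 * \<beta>) *\<^sub>R (B - C))"
    "C = C + 0 *\<^sub>R ((c2 * \<alpha>) *\<^sub>R (A - C) + (c1 * \<beta>) *\<^sub>R (B - C))"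
    using z nz assms by simp_all
  then have "B \<in> weighted_line \<gamma> \<alpha> B C A b1 b2 \<inter> weighted_line \<alpha> \<beta> C A B c2 c1"
    "C \<in> weighted_line \<gamma> \<alpha> B C A b1 b2 \<inter> weighted_line \<alpha> \<beta> C A B c2 c1"
    unfolding weighted_line_def by blast+
  then show False using assms by auto
qed

section \<open>Homogeneous vectors on cevians and joining lines\<close>

lemma affine_add_scaleR:
  assumes "affine S" "P \<in> S" "Q \<in> S" "T \<in> S"
  shows "p *\<^sub>R P + q *\<^sub>R Q + (1 - (p + q)) *\<^sub>R T \<in> S"
proof -
  have "T + p *\<^sub>R (P - T) \<in> S"
    using mem_affine[OF assms(1,4,2), of "1 - p" p] by (simp add: algebra_simps)
  then have "1 *\<^sub>R (T + p *\<^sub>R (P - T)) + q *\<^sub>R (Q - T) \<in> S"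
    using mem_affine_3_minus[OF assms(1) _ assms(3,4)] by simp
  then show ?thesis by (simp add: algebra_simps)
qed

text \<open>Adding \<open>(1 - w)\<close> times \<open>R\<close> raises the weight of
  \<open>V\<close> to 1 without leaving any of the three cevians, so the sum must be
  \<open>R\<close>. The argument covers \<open>w = 0\<close>, where it yields
  \<open>V = 0\<close>.\<close>

lemma cevian_meet:
  fixes A B C :: "'a::euclidean_space"
  assumes R: "affine hull {A, X} \<inter> affine hull {B, Y} \<inter> affine hull {C, Z} = {R}"
    and V: "V = p *\<^sub>R A + p' *\<^sub>R X" "V = q *\<^sub>R B + q' *\<^sub>R Y" "V = r *\<^sub>R C + r' *\<^sub>R Z"
    and w: "w = p + p'" "w = q + q'" "w = r + r'"
  shows "V = w *\<^sub>R R"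
proof -
  have "V + (1 - w) *\<^sub>R R \<in> affine hull {A, X}"
    unfolding V(1) w(1) by (rule affine_add_scaleR) (use R in \<open>auto simp: hull_inc\<close>)
  moreover have "V + (1 - w) *\<^sub>R R \<in> affine hull {B, Y}"
    unfolding V(2) w(2) by (rule affine_add_scaleR) (use R in \<open>auto simp: hull_inc\<close>)
  moreover have "V + (1 - w) *\<^sub>R R \<in> affine hull {C, Z}"
    unfolding V(3) w(3) by (rule affine_add_scaleR) (use R in \<open>auto simp: hull_inc\<close>)
  ultimately have "V + (1 - w) *\<^sub>R R = R" using R by blast
  then show ?thesis by (simp add: scaleR_diff_left)
qed

lemma homogeneous_point_in_affine_hull:
  fixes X X' :: "'a::real_vector"
  assumes "V = p *\<^sub>R X + q *\<^sub>R X'" "w = p + q" "w \<noteq> 0"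
  shows "(1 / w) *\<^sub>R V \<in> affine hull {X, X'}"
proof -
  have "p / w + q / w = 1" using assms by (simp add: add_divide_distrib[symmetric])
  moreover have "(1 / w) *\<^sub>R V = (p / w) *\<^sub>R X + (q / w) *\<^sub>R X'"
    using assms(1) by (simp add: scaleR_add_right)
  ultimately show ?thesis unfolding affine_hull_2 by blast
qed

text \<open>Weight 0 means a point at infinity: \<open>V\<close> is then a multiple of
  \<open>X' - X\<close>, nonzero by assumption, hence a direction of the line.\<close>

lemma affine_hull_direction:
  fixes X X' :: "'a::real_vector"
  assumes "V = p *\<^sub>R X + q *\<^sub>R X'" "p + q = 0" "V \<noteq> 0"
  shows "affine hull {X, X'} = range (\<lambda>t. X + t *\<^sub>R V)"
proof -
  have q: "q = - p" using assms(2) by simp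
  have V: "V = (- p) *\<^sub>R (X' - X)" using assms(1) unfolding q by (simp add: algebra_simps)
  with assms(3) have p: "p \<noteq> 0" by auto
  have "X + t *\<^sub>R (X' - X) = X + (- t / p) *\<^sub>R V" "X + t *\<^sub>R V = X + (- t * p) *\<^sub>R (X' - X)" for t
    using p unfolding V by simp_all
  then have "range (\<lambda>t. X + t *\<^sub>R (X' - X)) = range (\<lambda>t. X + t *\<^sub>R V)"
    by (metis (mono_tags, lifting) rangeE range_eqI subsetI subset_antisym)
  then show ?thesis unfolding affine_hull_2_alt .
qed

lemma affine_parallel_range:
  "affine_parallel (range (\<lambda>t. X + t *\<^sub>R V)) (range (\<lambda>t. Y + t *\<^sub>R V))"
  unfolding affine_parallel_def
  by (rule exI[of _ "Y - X"]) (simp add: image_image add.assoc[symmetric])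

theorem theorem3:
  fixes A B C X Y Z X' Y' Z' R R' :: "real^2"
    and lA lB lC lA' lB' lC' :: "(real^2) set"
  assumes triangle: "\<not> collinear {A, B, C}"
    and lines: "is_line lA" "A \<in> lA" "is_line lB" "B \<in> lB" "is_line lC" "C \<in> lC"
    and symmetric_lines:
      "lA' = reflect_in (angle_bisector A B C) ` lA"
      "lB' = reflect_in (angle_bisector B C A) ` lB"
      "lC' = reflect_in (angle_bisector C A B) ` lC"
    and XYZ: "lB \<inter> lC' = {X}" "lC \<inter> lA' = {Y}" "lA \<inter> lB' = {Z}"
    and XYZ': "lB' \<inter> lC = {X'}" "lC' \<inter> lA = {Y'}" "lA' \<inter> lB = {Z'}"
    and cevians_defined: "A \<noteq> X" "B \<noteq> Y" "C \<noteq> Z" "A \<noteq> X'" "B \<noteq> Y'" "C \<noteq> Z'"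
    and R: "affine hull {A, X} \<inter> affine hull {B, Y} \<inter> affine hull {C, Z} = {R}"
    and R': "affine hull {A, X'} \<inter> affine hull {B, Y'} \<inter> affine hull {C, Z'} = {R'}"
    and joins_defined: "X \<noteq> X'" "Y \<noteq> Y'" "Z \<noteq> Z'" "R \<noteq> R'"
  shows "(\<exists>P. P \<in> affine hull {X, X'} \<and> P \<in> affine hull {Y, Y'} \<and>
              P \<in> affine hull {Z, Z'} \<and> P \<in> affine hull {R, R'}) \<or>
         (affine_parallel (affine hull {X, X'}) (affine hull {Y, Y'}) \<and>
          affine_parallel (affine hull {X, X'}) (affine hull {Z, Z'}) \<and>
          affine_parallel (affine hull {X, X'}) (affine hull {R, R'}))"
proof -
  have tri: "\<not> collinear {B, C, A}" "\<not> collinear {C, A, B}"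
    using triangle by (simp_all add: insert_commute)
  have ne: "A \<noteq> B" "B \<noteq> C" "C \<noteq> A" using triangle by (auto simp: insert_commute)
  define \<alpha> \<beta> \<gamma> where "\<alpha> = dist B C" and "\<beta> = dist C A" and "\<gamma> = dist A B"
  have nz: "\<alpha> \<noteq> 0" "\<beta> \<noteq> 0" "\<gamma> \<noteq> 0" using ne by (simp_all add: \<alpha>_def \<beta>_def \<gamma>_def)
  obtain a1 a2 where a: "a1 \<noteq> 0 \<or> a2 \<noteq> 0" "lA = weighted_line \<beta> \<gamma> A B C a1 a2"
      "lA' = weighted_line \<beta> \<gamma> A B C a2 a1"
    using isogonal_lines[OF triangle lines(1,2)] symmetric_lines(1) unfolding \<beta>_def \<gamma>_def by metis
  obtain b1 b2 where b: "b1 \<noteq> 0 \<or> b2 \<noteq> 0" "lB = weighted_line \<gamma> \<alpha> B C A b1 b2"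
      "lB' = weighted_line \<gamma> \<alpha> B C A b2 b1"
    using isogonal_lines[OF tri(1) lines(3,4)] symmetric_lines(2) unfolding \<gamma>_def \<alpha>_def by metis
  obtain c1 c2 where c: "c1 \<noteq> 0 \<or> c2 \<noteq> 0" "lC = weighted_line \<alpha> \<beta> C A B c1 c2"
      "lC' = weighted_line \<alpha> \<beta> C A B c2 c1"
    using isogonal_lines[OF tri(2) lines(5,6)] symmetric_lines(3) unfolding \<alpha>_def \<beta>_def by metis
  \<comment> \<open>\<open>H x y z\<close> is the homogeneous vector with trilinear coordinates
    \<open>x : y : z\<close>, and \<open>W x y z\<close> is its weight, the sum of the barycentric
    coordinates.\<close>
  define H where "H x y z = (x * \<alpha>) *\<^sub>R A + (y * \<beta>) *\<^sub>R B + (z * \<gamma>) *\<^sub>R C" for x y z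
  define W where "W x y z = x * \<alpha> + y * \<beta> + z * \<gamma>" for x y z
  have X: "H (b2 * c2) (b2 * c1) (b1 * c2) = W (b2 * c2) (b2 * c1) (b1 * c2) *\<^sub>R X"
    and X': "H (b1 * c1) (b1 * c2) (b2 * c1) = W (b1 * c1) (b1 * c2) (b2 * c1) *\<^sub>R X'"
    and Y: "H (c1 * a2) (c2 * a2) (c2 * a1) = W (c1 * a2) (c2 * a2) (c2 * a1) *\<^sub>R Y"
    and Y': "H (c2 * a1) (c1 * a1) (c1 * a2) = W (c2 * a1) (c1 * a1) (c1 * a2) *\<^sub>R Y'"
    and Z: "H (a2 * b1) (a1 * b2) (a2 * b2) = W (a2 * b1) (a1 * b2) (a2 * b2) *\<^sub>R Z"
    and Z': "H (a1 * b2) (a2 * b1) (a1 * b1) = W (a1 * b2) (a2 * b1) (a1 * b1) *\<^sub>R Z'"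
    using weighted_line_meet[OF XYZ(1)[unfolded b c]] weighted_line_meet[OF XYZ'(1)[unfolded b c]]
      weighted_line_meet[OF XYZ(2)[unfolded c a]] weighted_line_meet[OF XYZ'(2)[unfolded c a]]
      weighted_line_meet[OF XYZ(3)[unfolded a b]] weighted_line_meet[OF XYZ'(3)[unfolded a b]]
    by (simp_all add: H_def W_def ac_simps)
  have W0: "x = 0 \<and> y = 0 \<and> z = 0" if "W x y z = 0" "H x y z = 0" for x y z
    using noncollinear_independent[OF triangle that(2)[unfolded H_def] that(1)[unfolded W_def]] nz
    by simp
  \<comment> \<open>Weight 0 would force the vector itself to vanish by \<open>X\<close>, hence all
    its coordinates by \<open>W0\<close>, against the nontriviality lemma.\<close>
  have wX: "W (b2 * c2) (b2 * c1) (b1 * c2) \<noteq> 0"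
    using W0[of "b2 * c2" "b2 * c1" "b1 * c2"] X a(1) b(1) c(1)
      weighted_line_meet_nontrivial[OF XYZ(1)[unfolded b c] ne(2) nz(2,3) b(1) c(1)]
    by auto
  have wX': "W (b1 * c1) (b1 * c2) (b2 * c1) \<noteq> 0"
    using W0[of "b1 * c1" "b1 * c2" "b2 * c1"] X' a(1) b(1) c(1)
      weighted_line_meet_nontrivial[OF XYZ'(1)[unfolded b c] ne(2) nz(2,3)]
    by auto

  let ?VR = "H (a2 * b1 * c1) (a1 * b2 * c1) (a1 * b1 * c2)"
  let ?wR = "W (a2 * b1 * c1) (a1 * b2 * c1) (a1 * b1 * c2)"
  let ?VR' = "H (a1 * b2 * c2) (a2 * b1 * c2) (a2 * b2 * c1)"
  let ?wR' = "W (a1 * b2 * c2) (a2 * b1 * c2) (a2 * b2 * c1)"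
  \<comment> \<open>\<open>?VR\<close> minus \<open>a1\<close> times the vector of \<open>X\<close>
    has only an \<open>A\<close> coordinate, namely \<open>?kA\<close>; for \<open>?VR'\<close>,
    \<open>a2\<close> and \<open>X'\<close> it is \<open>- ?kA\<close>. These terms cancel in
    \<open>?VR + ?VR'\<close>, leaving a combination of \<open>X\<close> and \<open>X'\<close>
    alone. The same holds for \<open>?kB\<close> and \<open>?kC\<close>.\<close>
  let ?kA = "a2 * b1 * c1 - a1 * b2 * c2" and ?kB = "a1 * b2 * c1 - a2 * b1 * c2"
    and ?kC = "a1 * b1 * c2 - a2 * b2 * c1"
  have VR: "?VR = ?wR *\<^sub>R R"
  proof (rule cevian_meet[OF R])
    show "?VR = (?kA * \<alpha>) *\<^sub>R A + (a1 * W (b2 * c2) (b2 * c1) (b1 * c2)) *\<^sub>R X"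
      unfolding scaleR_scaleR[symmetric] X[symmetric] by (simp add: H_def algebra_simps)
    show "?VR = (?kB * \<beta>) *\<^sub>R B + (b1 * W (c1 * a2) (c2 * a2) (c2 * a1)) *\<^sub>R Y"
      unfolding scaleR_scaleR[symmetric] Y[symmetric] by (simp add: H_def algebra_simps)
    show "?VR = (?kC * \<gamma>) *\<^sub>R C + (c1 * W (a2 * b1) (a1 * b2) (a2 * b2)) *\<^sub>R Z"
      unfolding scaleR_scaleR[symmetric] Z[symmetric] by (simp add: H_def algebra_simps)
  qed (simp_all add: W_def algebra_simps)
  have VR': "?VR' = ?wR' *\<^sub>R R'"
  proof (rule cevian_meet[OF R'])
    show "?VR' = (- ?kA * \<alpha>) *\<^sub>R A + (a2 * W (b1 * c1) (b1 * c2) (b2 * c1)) *\<^sub>R X'"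
      unfolding scaleR_scaleR[symmetric] X'[symmetric] by (simp add: H_def algebra_simps)
    show "?VR' = (- ?kB * \<beta>) *\<^sub>R B + (b2 * W (c2 * a1) (c1 * a1) (c1 * a2)) *\<^sub>R Y'"
      unfolding scaleR_scaleR[symmetric] Y'[symmetric] by (simp add: H_def algebra_simps)
    show "?VR' = (- ?kC * \<gamma>) *\<^sub>R C + (c2 * W (a1 * b2) (a2 * b1) (a1 * b1)) *\<^sub>R Z'"
      unfolding scaleR_scaleR[symmetric] Z'[symmetric] by (simp add: H_def algebra_simps)
  qed (simp_all add: W_def algebra_simps)

  define V w where "V = ?VR + ?VR'" and "w = ?wR + ?wR'"
  have VX: "V = (a1 * W (b2 * c2) (b2 * c1) (b1 * c2)) *\<^sub>R X
      + (a2 * W (b1 * c1) (b1 * c2) (b2 * c1)) *\<^sub>R X'"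
    unfolding V_def scaleR_scaleR[symmetric] X[symmetric] X'[symmetric]
    by (simp add: H_def algebra_simps)
  have VY: "V = (b1 * W (c1 * a2) (c2 * a2) (c2 * a1)) *\<^sub>R Y
      + (b2 * W (c2 * a1) (c1 * a1) (c1 * a2)) *\<^sub>R Y'"
    unfolding V_def scaleR_scaleR[symmetric] Y[symmetric] Y'[symmetric]
    by (simp add: H_def algebra_simps)
  have VZ: "V = (c1 * W (a2 * b1) (a1 * b2) (a2 * b2)) *\<^sub>R Z
      + (c2 * W (a1 * b2) (a2 * b1) (a1 * b1)) *\<^sub>R Z'"
    unfolding V_def scaleR_scaleR[symmetric] Z[symmetric] Z'[symmetric]
    by (simp add: H_def algebra_simps)
  have VRR: "V = ?wR *\<^sub>R R + ?wR' *\<^sub>R R'"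
    unfolding V_def VR VR' ..
  have wX_sum: "w = a1 * W (b2 * c2) (b2 * c1) (b1 * c2) + a2 * W (b1 * c1) (b1 * c2) (b2 * c1)"
    and wY_sum: "w = b1 * W (c1 * a2) (c2 * a2) (c2 * a1) + b2 * W (c2 * a1) (c1 * a1) (c1 * a2)"
    and wZ_sum: "w = c1 * W (a2 * b1) (a1 * b2) (a2 * b2) + c2 * W (a1 * b2) (a2 * b1) (a1 * b1)"
    by (simp_all add: w_def W_def algebra_simps)

  show ?thesis
  proof (cases "w = 0")
    case False
    have "(1 / w) *\<^sub>R V \<in> affine hull {X, X'}" "(1 / w) *\<^sub>R V \<in> affine hull {Y, Y'}"
      "(1 / w) *\<^sub>R V \<in> affine hull {Z, Z'}" "(1 / w) *\<^sub>R V \<in> affine hull {R, R'}"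
      using homogeneous_point_in_affine_hull[OF VX wX_sum False]
        homogeneous_point_in_affine_hull[OF VY wY_sum False]
        homogeneous_point_in_affine_hull[OF VZ wZ_sum False]
        homogeneous_point_in_affine_hull[OF VRR w_def False] by blast+
    then show ?thesis by blast
  next
    case True
    \<comment> \<open>In this case the common point is at infinity, and \<open>V\<close> serves as a
      common direction. If it vanished, \<open>X\<close> and \<open>X'\<close> being distinct would
      make both coefficients in \<open>VX\<close> zero, and the nonzero weights would give
      \<open>a1 = a2 = 0\<close>.\<close>
    have "V \<noteq> 0"
    proof
      assume "V = 0"
      let ?p = "a1 * W (b2 * c2) (b2 * c1) (b1 * c2)" and ?q = "a2 * W (b1 * c1) (b1 * c2) (b2 * c1)"
      have q: "?q = - ?p" using True wX_sum by simp
      have "?p *\<^sub>R (X - X') = 0"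
        using VX \<open>V = 0\<close> unfolding q by (simp add: scaleR_diff_right)
      then have "?p = 0" using joins_defined(1) by simp
      then show False using q wX wX' a(1) by auto
    qed
    from affine_hull_direction[OF VX _ this] affine_hull_direction[OF VY _ this]
      affine_hull_direction[OF VZ _ this] affine_hull_direction[OF VRR _ this]
    show ?thesis
      using True wX_sum wY_sum wZ_sum w_def by (simp add: affine_parallel_range)
  qed
qed

end
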